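(* Let $\mathcal M=(\mathcal S,s_{\rm init},g,\mathcal A,P)$ be a stochastic shortest path (SSP) instance and let $\mathring{\mathcal M}$ be its stacked discounted version with $H\ge 1$ layers, discount factor $\gamma\in(0,1)$ and terminal cost $c_f\ge 0$. For any cost function $c:\mathcal S\times\mathcal A\to[0,1]$, $$V^{\pi,P,c}(s,h)\le\frac{H-h+1}{1-\gamma}+c_f$$ for every $h\in[H]$, $s\in\mathcal S$ and every stationary policy $\pi$ in $\mathring{\mathcal M}$. Moreover, if $\gamma=1-\frac{1}{2T_{\max}}$, then $$Q^{\mathring\pi^\star,P,c}(s,a,h)\le Q^{\pi^\star,P,c}(s,a)+\frac{c_f}{2^{H-h+1}}$$ for every $h\in[H]$ and $(s,a)\in\mathcal S\times\mathcal A$.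
   Context: SSP. $\mathcal M=(\mathcal S,s_{\rm init},g,\mathcal A,P)$ consists of a finite state space $\mathcal S$, initial state $s_{\rm init}\in\mathcal S$, goal state $g\notin\mathcal S$, finite action space $\mathcal A$ and transition function $P=\{P_{s,a}\}$ with $P_{s,a}\in\Delta_{\mathcal S_+}$, $\mathcal S_+=\mathcal S\cup\{g\}$ ($\Delta_X$ is the probability simplex over $X$). A stationary policy $\pi:\mathcal S\to\Delta_{\mathcal A}$ is proper if following it from any state reaches $g$ with probability 1. For a cost function $c:\mathcal S\times\mathcal A\to[0,1]$, $V^{\pi,P,c}(s)$ is the expected total cost until reaching $g$ when following $\pi$ from $s$, and $Q^{\pi,P,c}(s,a)=c(s,a)+\mathbb E_{s'\sim P_{s,a}}[V^{\pi,P,c}(s')]$ with $V^{\pi,P,c}(g)=0$. $\pi^\star$ is the fixed optimal proper policy of the learning problem (it need not be optimal for the arbitrary cost function $c$ of the statement). $T^\pi(s)$ is one plus the expected number of steps to reach $g$ following $\pi$ from $s$, and $T_{\max}=\max_s T^{\pi^\star}(s)$. Stacked discounted version. $\mathring{\mathcal M}$ has state space $\mathring{\mathcal S}=\mathcal S\times[H+1]$, initial state $(s_{\rm init},1)$, goal $g$, actions $\mathcal A$, and transitions: for $h\le H$, from $((s,h),a)$ go to $(s',h)$ with probability $\gamma P_{s,a}(s')$, to $(s',h+1)$ with probability $(1-\gamma)P_{s,a}(s')$ (for $s'\in\mathcal S$), and to $g$ with probability $P_{s,a}(g)$; from $((s,H+1),a)$ go to $g$ with probability 1. A cost function $c$ of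 $\mathcal M$ is extended by $c(s,a,h)=c(s,a)$ for $h\le H$ and $c(s,a,H+1)=c_f$. For a stationary policy $\pi(\cdot|s,h)$ in $\mathring{\mathcal M}$, $V^{\pi,P,c}(s,h)$ and $Q^{\pi,P,c}(s,a,h)$ denote the expected total (extended) cost until reaching $g$ in $\mathring{\mathcal M}$, starting from $(s,h)$, respectively from $(s,h)$ with first action $a$. The policy $\mathring\pi^\star$ in $\mathring{\mathcal M}$ is $\mathring\pi^\star(\cdot|s,h)=\pi^\star(\cdot|s)$. *)

theory Defs
  imports "HOL-Probability.Probability"
begin

text \<open>
  The goal state is \<^term>\<open>None\<close>: the transition function takes values in the distributions over
  \<^typ>\<open>'s option\<close>, so the goal is automatically distinct from all states.
\<close>

record ('s, 'a) ssp =
  states :: "'s set"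
  init :: 's
  actions :: "'a set"
  transition :: "'s \<Rightarrow> 'a \<Rightarrow> 's option pmf"

definition is_ssp :: "('s, 'a) ssp \<Rightarrow> bool" where
  "is_ssp M \<longleftrightarrow>
     finite (states M) \<and> init M \<in> states M \<and> finite (actions M) \<and> actions M \<noteq> {} \<and>
     (\<forall>s\<in>states M. \<forall>a\<in>actions M. set_pmf (transition M s a) \<subseteq> insert None (Some ` states M))"

definition is_policy :: "('s, 'a) ssp \<Rightarrow> ('s \<Rightarrow> 'a pmf) \<Rightarrow> bool" where
  "is_policy M \<pi> \<longleftrightarrow> (\<forall>s\<in>states M. set_pmf (\<pi> s) \<subseteq> actions M)"


text \<open>
  Law of a discrete-time Markov chain with initial distribution \<open>\<mu>\<close> and kernel \<open>K\<close>, as a measure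
  on infinite trajectories, obtained from the Ionescu-Tulcea theorem.
\<close>

definition chain_kernel ::
  "'x pmf \<Rightarrow> ('x \<Rightarrow> 'x pmf) \<Rightarrow> nat \<Rightarrow> (nat \<Rightarrow> 'x) \<Rightarrow> 'x measure" where
  "chain_kernel \<mu> K i \<omega> = measure_pmf (if i = 0 then \<mu> else K (\<omega> (i - 1)))"

lemma Ionescu_Tulcea_chain:
  fixes \<mu> :: "'x pmf"
  shows "Ionescu_Tulcea (chain_kernel \<mu> K) (\<lambda>_. count_space UNIV)"
proof (rule Ionescu_Tulcea.intro)
  fix i :: nat
  let ?A = "PiM {0..<i} (\<lambda>_. count_space UNIV) :: (nat \<Rightarrow> 'x) measure"
  show "chain_kernel \<mu> K i \<in> measurable ?A (subprob_algebra (count_space UNIV))"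
  proof (cases "i = 0")
    case True
    then show ?thesis
      by (auto simp: chain_kernel_def[abs_def] space_subprob_algebra
          prob_space_imp_subprob_space measure_pmf.prob_space_axioms intro!: measurable_const)
  next
    case False
    then have "(\<lambda>\<omega>. \<omega> (i - 1)) \<in> measurable ?A (count_space UNIV)"
      by (intro measurable_component_singleton) auto
    moreover have "(\<lambda>x. measure_pmf (K x)) \<in>
        measurable (count_space UNIV) (subprob_algebra (count_space UNIV))"
      by (auto simp: space_subprob_algebra prob_space_imp_subprob_space
          measure_pmf.prob_space_axioms)
    ultimately have "(\<lambda>\<omega>. measure_pmf (K (\<omega> (i - 1)))) \<in>
        measurable ?A (subprob_algebra (count_space UNIV))"
      by (rule measurable_compose)
    then show ?thesis
      using False by (simp add: chain_kernel_def[abs_def])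
  qed
next
  fix i :: nat and x :: "nat \<Rightarrow> 'x"
  show "prob_space (chain_kernel \<mu> K i x)"
    by (simp add: chain_kernel_def measure_pmf.prob_space_axioms)
qed

definition chain_measure :: "'x pmf \<Rightarrow> ('x \<Rightarrow> 'x pmf) \<Rightarrow> (nat \<Rightarrow> 'x) measure" where
  "chain_measure \<mu> K =
     projective_family.lim UNIV
       (Ionescu_Tulcea.CI (chain_kernel \<mu> K) (\<lambda>_. count_space UNIV)) (\<lambda>_. count_space UNIV)"

lemma sets_chain_measure [simp, measurable_cong]:
  "sets (chain_measure \<mu> K) = sets (PiM UNIV (\<lambda>_. count_space UNIV))"
proof -
  interpret Ionescu_Tulcea "chain_kernel \<mu> K" "\<lambda>_. count_space UNIV"
    by (rule Ionescu_Tulcea_chain)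
  show ?thesis
    by (simp add: chain_measure_def)
qed

lemma space_chain_measure [simp]: "space (chain_measure \<mu> K) = UNIV"
  using sets_eq_imp_space_eq[OF sets_chain_measure, of \<mu> K] by (simp add: space_PiM)

lemma emeasure_chain_measure_prefix:
  fixes \<mu> :: "'x pmf"
  shows "emeasure (chain_measure \<mu> K) {\<omega>. \<forall>i\<le>n. \<omega> i = x i} =
     ennreal (pmf \<mu> (x 0) * (\<Prod>i<n. pmf (K (x i)) (x (Suc i))))"
proof -
  let ?M = "\<lambda>_::nat. count_space (UNIV :: 'x set)"
  interpret Ionescu_Tulcea "chain_kernel \<mu> K" ?M
    by (rule Ionescu_Tulcea_chain)
  define X where "X n = {restrict x {0..<Suc n}}" for n
  have X_PiE: "X n = (\<Pi>\<^sub>E i\<in>{0..<Suc n}. {x i})" for n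
    by (auto simp: X_def fun_eq_iff PiE_iff extensional_def restrict_def)
  have X_sets [measurable]: "X n \<in> sets (PiM {0..<Suc n} ?M)" for n
    unfolding X_PiE by (intro sets_PiM_I_finite) auto
  have upd: "(\<lambda>y. fun_upd \<omega> n y) -` X n = (if restrict \<omega> {0..<n} = restrict x {0..<n} then {x n} else {})"
    if "\<omega> \<in> space (PiM {0..<n} ?M)" for \<omega> n
  proof -
    have "fun_upd \<omega> n y \<in> X n \<longleftrightarrow> restrict \<omega> {0..<n} = restrict x {0..<n} \<and> y = x n" for y
      using that unfolding X_PiE
      by (auto simp: space_PiM PiE_iff extensional_def fun_eq_iff restrict_def less_Suc_eq)
    then show ?thesis by auto
  qed
  have C: "emeasure (C 0 (Suc n) (\<lambda>_. undefined)) (X n) =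
     ennreal (pmf \<mu> (x 0) * (\<Prod>i<n. pmf (K (x i)) (x (Suc i))))" for n
  proof (induction n)
    case 0
    have "emeasure (C 0 (Suc 0) (\<lambda>_. undefined)) (X 0) = emeasure (eP 0 (\<lambda>_. undefined)) (X 0)"
      using measurable_eP[of 0] by (simp add: bind_return[where N="PiM {0..<Suc 0} ?M"])
    also have "\<dots> = emeasure (chain_kernel \<mu> K 0 (\<lambda>_. undefined))
        ((\<lambda>y. fun_upd (\<lambda>_. undefined) 0 y) -` X 0 \<inter> UNIV)"
      using X_sets[of 0] by (subst emeasure_eP) (auto simp: chain_kernel_def)
    also have "\<dots> = pmf \<mu> (x 0)"
      using upd[of "\<lambda>_. undefined" 0]
      by (simp add: chain_kernel_def emeasure_pmf_single restrict_def)
    finally show ?case by simp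
  next
    case (Suc n)
    have eP_X: "emeasure (eP (Suc n) \<omega>) (X (Suc n)) =
        ennreal (pmf (K (x n)) (x (Suc n))) * indicator (X n) \<omega>"
      if "\<omega> \<in> space (PiM {0..<Suc n} ?M)" for \<omega>
    proof -
      have "restrict \<omega> {0..<Suc n} = \<omega>"
        using that by (auto simp: space_PiM PiE_iff intro!: extensional_restrict)
      moreover from this have "\<omega> n = x n" if "\<omega> = restrict x {0..<Suc n}"
        using that by simp
      ultimately show ?thesis
        using that X_sets[of "Suc n"] upd[of \<omega> "Suc n"]
        by (subst emeasure_eP)
          (auto simp: chain_kernel_def emeasure_pmf_single X_def[of n] split: split_indicator)
    qed
    have "emeasure (C 0 (Suc (Suc n)) (\<lambda>_. undefined)) (X (Suc n)) =
        (\<integral>\<^sup>+\<omega>. emeasure (eP (Suc n) \<omega>) (X (Suc n)) \<partial>C 0 (Suc n) (\<lambda>_. undefined))"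
      using measurable_eP[of "Suc n"] X_sets[of "Suc n"]
      unfolding C.simps(2)[of 0 "Suc n"]
      by (subst emeasure_bind[where N="PiM {0..<Suc (Suc n)} ?M"])
        (auto simp: space_C measurable_cong_sets[OF sets_C] simp del: C.simps)
    also have "\<dots> = (\<integral>\<^sup>+\<omega>. ennreal (pmf (K (x n)) (x (Suc n))) * indicator (X n) \<omega>
        \<partial>C 0 (Suc n) (\<lambda>_. undefined))"
      by (intro nn_integral_cong eP_X) (simp add: space_C del: C.simps)
    also have "\<dots> = ennreal (pmf (K (x n)) (x (Suc n))) * emeasure (C 0 (Suc n) (\<lambda>_. undefined)) (X n)"
      using X_sets[of n] by (subst nn_integral_cmult_indicator) (auto simp: sets_C simp del: C.simps)
    also have "\<dots> = ennreal (pmf \<mu> (x 0) * (\<Prod>i<Suc n. pmf (K (x i)) (x (Suc i))))"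
      unfolding Suc.IH by (subst ennreal_mult[symmetric]) (auto simp: mult_ac prod_nonneg)
    finally show ?case .
  qed
  have emb: "{\<omega>. \<forall>i\<le>n. \<omega> i = x i} = PF.emb UNIV {0..<Suc n} (X n)"
    by (auto simp: prod_emb_def X_PiE PiE_iff less_Suc_eq_le)
  have "emeasure (chain_measure \<mu> K) {\<omega>. \<forall>i\<le>n. \<omega> i = x i} = emeasure (CI {0..<Suc n}) (X n)"
    unfolding emb chain_measure_def by (intro lim) auto
  also have "\<dots> = emeasure (C 0 (Suc n) (\<lambda>_. undefined)) (PF.emb {0..<Suc n} {0..<Suc n} (X n))"
    by (intro emeasure_CI) auto
  also have "PF.emb {0..<Suc n} {0..<Suc n} (X n) = X n"
    by (rule prod_emb_id) (auto simp: X_PiE PiE_iff)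
  finally show ?thesis
    using C[of n] by simp
qed

lemma prob_space_chain_measure: "prob_space (chain_measure \<mu> K)"
proof -
  interpret Ionescu_Tulcea "chain_kernel \<mu> K" "\<lambda>_. count_space UNIV"
    by (rule Ionescu_Tulcea_chain)
  interpret CI: prob_space "CI {}"
    by (rule PF.prob_space_P) auto
  have "emeasure PF.lim (PF.emb UNIV {} (space (CI {}))) = emeasure (CI {}) (space (CI {}))"
    by (intro lim) (auto simp: CI_def)
  also have "PF.emb UNIV {} (space (CI {})) = UNIV"
    by (auto simp: prod_emb_def CI_def space_PiM restrict_def)
  finally show ?thesis
    unfolding chain_measure_def
    by (intro prob_spaceI) (simp add: CI.emeasure_space_1 space_PiM)
qed


text \<open>
  Trajectories are sequences of state-action pairs; after the goal has been reached the trajectory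
  is constantly \<^term>\<open>None\<close>.
\<close>

definition start :: "('s \<Rightarrow> 'a pmf) \<Rightarrow> 's option \<Rightarrow> ('s \<times> 'a) option pmf" where
  "start \<pi> x = (case x of None \<Rightarrow> return_pmf None | Some s \<Rightarrow> map_pmf (\<lambda>a. Some (s, a)) (\<pi> s))"

definition step ::
  "('s, 'a) ssp \<Rightarrow> ('s \<Rightarrow> 'a pmf) \<Rightarrow> ('s \<times> 'a) option \<Rightarrow> ('s \<times> 'a) option pmf" where
  "step M \<pi> x =
     (case x of None \<Rightarrow> return_pmf None | Some (s, a) \<Rightarrow> bind_pmf (transition M s a) (start \<pi>))"

definition traj_from :: "('s, 'a) ssp \<Rightarrow> ('s \<Rightarrow> 'a pmf) \<Rightarrow> 's \<Rightarrow> (nat \<Rightarrow> ('s \<times> 'a) option) measure" where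
  "traj_from M \<pi> s = chain_measure (start \<pi> (Some s)) (step M \<pi>)"

definition traj_from_action ::
  "('s, 'a) ssp \<Rightarrow> ('s \<Rightarrow> 'a pmf) \<Rightarrow> 's \<Rightarrow> 'a \<Rightarrow> (nat \<Rightarrow> ('s \<times> 'a) option) measure" where
  "traj_from_action M \<pi> s a = chain_measure (return_pmf (Some (s, a))) (step M \<pi>)"

definition proper :: "('s, 'a) ssp \<Rightarrow> ('s \<Rightarrow> 'a pmf) \<Rightarrow> bool" where
  "proper M \<pi> \<longleftrightarrow> is_policy M \<pi> \<and> (\<forall>s\<in>states M. AE \<omega> in traj_from M \<pi> s. \<exists>t. \<omega> t = None)"

text \<open>
  Values are extended nonnegative reals, so that an inequality between them includes finiteness of
  its left-hand side whenever the right-hand side is finite; no integrability condition is hidden.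
\<close>

definition total_cost :: "('s \<Rightarrow> 'a \<Rightarrow> real) \<Rightarrow> (nat \<Rightarrow> ('s \<times> 'a) option) \<Rightarrow> ennreal" where
  "total_cost c \<omega> = (\<Sum>t. case \<omega> t of None \<Rightarrow> 0 | Some (s, a) \<Rightarrow> ennreal (c s a))"

definition V :: "('s, 'a) ssp \<Rightarrow> ('s \<Rightarrow> 'a pmf) \<Rightarrow> ('s \<Rightarrow> 'a \<Rightarrow> real) \<Rightarrow> 's \<Rightarrow> ennreal" where
  "V M \<pi> c s = (\<integral>\<^sup>+\<omega>. total_cost c \<omega> \<partial>traj_from M \<pi> s)"

definition Q :: "('s, 'a) ssp \<Rightarrow> ('s \<Rightarrow> 'a pmf) \<Rightarrow> ('s \<Rightarrow> 'a \<Rightarrow> real) \<Rightarrow> 's \<Rightarrow> 'a \<Rightarrow> ennreal" where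
  "Q M \<pi> c s a =
     ennreal (c s a) +
     (\<integral>\<^sup>+x. (case x of None \<Rightarrow> 0 | Some s' \<Rightarrow> V M \<pi> c s') \<partial>measure_pmf (transition M s a))"

definition Q_first_action ::
  "('s, 'a) ssp \<Rightarrow> ('s \<Rightarrow> 'a pmf) \<Rightarrow> ('s \<Rightarrow> 'a \<Rightarrow> real) \<Rightarrow> 's \<Rightarrow> 'a \<Rightarrow> ennreal" where
  "Q_first_action M \<pi> c s a = (\<integral>\<^sup>+\<omega>. total_cost c \<omega> \<partial>traj_from_action M \<pi> s a)"

definition steps_to_goal :: "(nat \<Rightarrow> ('s \<times> 'a) option) \<Rightarrow> ennreal" where
  "steps_to_goal \<omega> = (INF t\<in>{t. \<omega> t = None}. of_nat t)"

definition T :: "('s, 'a) ssp \<Rightarrow> ('s \<Rightarrow> 'a pmf) \<Rightarrow> 's \<Rightarrow> ennreal" where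
  "T M \<pi> s = 1 + (\<integral>\<^sup>+\<omega>. steps_to_goal \<omega> \<partial>traj_from M \<pi> s)"

text \<open>The maximum is finite for a proper policy, as the state space is finite.\<close>

definition T_max :: "('s, 'a) ssp \<Rightarrow> ('s \<Rightarrow> 'a pmf) \<Rightarrow> ennreal" where
  "T_max M \<pi> = Max (T M \<pi> ` states M)"


text \<open>Layers are numbered \<open>1, \<dots>, H + 1\<close>.\<close>

definition stacked_transition ::
  "('s, 'a) ssp \<Rightarrow> nat \<Rightarrow> real \<Rightarrow> 's \<times> nat \<Rightarrow> 'a \<Rightarrow> ('s \<times> nat) option pmf" where
  "stacked_transition M H \<gamma> sh a = (case sh of (s, h) \<Rightarrow>
     if h \<le> H then
       bind_pmf (transition M s a) (\<lambda>x. case x of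
           None \<Rightarrow> return_pmf None
         | Some s' \<Rightarrow> map_pmf (\<lambda>stay. Some (s', if stay then h else h + 1)) (bernoulli_pmf \<gamma>))
     else return_pmf None)"

definition stacked :: "('s, 'a) ssp \<Rightarrow> nat \<Rightarrow> real \<Rightarrow> ('s \<times> nat, 'a) ssp" where
  "stacked M H \<gamma> =
     \<lparr>states = states M \<times> {1..H + 1}, init = (init M, 1), actions = actions M,
      transition = stacked_transition M H \<gamma>\<rparr>"

definition stacked_cost :: "nat \<Rightarrow> real \<Rightarrow> ('s \<Rightarrow> 'a \<Rightarrow> real) \<Rightarrow> 's \<times> nat \<Rightarrow> 'a \<Rightarrow> real" where
  "stacked_cost H c\<^sub>f c sh a = (case sh of (s, h) \<Rightarrow> if h \<le> H then c s a else c\<^sub>f)"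

definition stacked_policy :: "('s \<Rightarrow> 'a pmf) \<Rightarrow> 's \<times> nat \<Rightarrow> 'a pmf" where
  "stacked_policy \<pi> sh = \<pi> (fst sh)"

lemma is_ssp_stacked: "is_ssp M \<Longrightarrow> is_ssp (stacked M H \<gamma>)"
  by (fastforce simp: is_ssp_def stacked_def stacked_transition_def split: option.splits if_splits)

lemma
  assumes "h \<le> H" "0 \<le> \<gamma>" "\<gamma> \<le> 1"
  shows pmf_stacked_stay:
      "pmf (stacked_transition M H \<gamma> (s, h) a) (Some (s', h)) = \<gamma> * pmf (transition M s a) (Some s')"
    and pmf_stacked_next:
      "pmf (stacked_transition M H \<gamma> (s, h) a) (Some (s', h + 1)) =
         (1 - \<gamma>) * pmf (transition M s a) (Some s')"
    and pmf_stacked_goal: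
      "pmf (stacked_transition M H \<gamma> (s, h) a) None = pmf (transition M s a) None"
proof -
  let ?f = "\<lambda>x. case x of None \<Rightarrow> return_pmf None
    | Some s' \<Rightarrow> map_pmf (\<lambda>stay. Some (s', if stay then h else h + 1)) (bernoulli_pmf \<gamma>)"
  have f: "pmf (?f x) y = (case x of None \<Rightarrow> indicator {None} y
     | Some s' \<Rightarrow> \<gamma> * indicator {Some (s', h)} y + (1 - \<gamma>) * indicator {Some (s', h + 1)} y)" for x y
    using assms by (auto simp: pmf_bind map_pmf_def split: option.splits split_indicator)
  have *: "pmf (stacked_transition M H \<gamma> (s, h) a) y =
      measure_pmf.expectation (transition M s a) (\<lambda>x. pmf (?f x) y)" for y
    using assms by (simp add: stacked_transition_def pmf_bind)
  have "(\<lambda>x. pmf (?f x) (Some (s', h))) = (\<lambda>x. \<gamma> * indicator {Some s'} x)"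
    "(\<lambda>x. pmf (?f x) (Some (s', h + 1))) = (\<lambda>x. (1 - \<gamma>) * indicator {Some s'} x)"
    "(\<lambda>x. pmf (?f x) None) = indicator {None}"
    unfolding f by (auto simp: fun_eq_iff split: option.splits split_indicator)
  note e = this
  show "pmf (stacked_transition M H \<gamma> (s, h) a) (Some (s', h)) = \<gamma> * pmf (transition M s a) (Some s')"
    unfolding * e by (simp add: measure_pmf_single)
  show "pmf (stacked_transition M H \<gamma> (s, h) a) (Some (s', h + 1)) =
      (1 - \<gamma>) * pmf (transition M s a) (Some s')"
    unfolding * e by (simp add: measure_pmf_single)
  show "pmf (stacked_transition M H \<gamma> (s, h) a) None = pmf (transition M s a) None"
    unfolding * e by (simp add: measure_pmf_single)
qed

end

theory Submission
  imports Defs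
begin

text \<open>
  The expected total cost of an absorbing chain is the least nonnegative \<open>W\<close> with
  \<open>c + K W \<le> W\<close>, so both bounds follow by exhibiting a supersolution \<open>W\<close> of the stacked chain.
  For the first one, \<open>W = (H - h + 1) / (1 - \<gamma>) + c\<^sub>f\<close>, which pays for the expected
  number \<open>1 / (1 - \<gamma>)\<close> of steps spent in each layer. For the second one,
  \<open>W = Q + c\<^sub>f p\<close> with \<open>p = 2 (1 - \<gamma>) n / 2 ^ (H - h + 1)\<close> in layers \<open>h \<le> H\<close> and \<open>p = 1\<close> in
  layer \<open>H + 1\<close>, where \<open>n\<close> is the expected number of states of the original chain visited after
  the current one. As \<open>n \<le> T_max = 1 / (2 (1 - \<gamma>))\<close>, one has \<open>p \<le> 1 / 2 ^ (H - h + 1)\<close>; and \<open>p\<close> is a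
  supersolution because a step leads to the next layer with probability \<open>1 - \<gamma>\<close>, where \<open>p\<close> is
  at most \<open>1 / 2 ^ (H - h)\<close>.
\<close>

section \<open>Expectations along the chain as iterates of its transition operator\<close>

text \<open>The projective limit has the finite iterated-kernel measures as marginals. Integrals of
  functions of finitely many coordinates can thus be computed by unrolling one kernel at a
  time.\<close>

lemma nn_integral_chain_measure_restrict:
  fixes \<mu> :: "'x pmf"
  assumes F [measurable]: "F \<in> borel_measurable (PiM {0..<n} (\<lambda>_. count_space UNIV))"
  shows "(\<integral>\<^sup>+\<omega>. F (restrict \<omega> {0..<n}) \<partial>chain_measure \<mu> K) =
    (\<integral>\<^sup>+\<omega>. F \<omega> \<partial>Ionescu_Tulcea.C (chain_kernel \<mu> K) (\<lambda>_. count_space UNIV) 0 n (\<lambda>_. undefined))"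
proof -
  let ?M = "\<lambda>_::nat. count_space (UNIV :: 'x set)"
  interpret Ionescu_Tulcea "chain_kernel \<mu> K" ?M
    by (rule Ionescu_Tulcea_chain)
  have "CI {0..<n} = C 0 n (\<lambda>_. undefined)"
  proof (rule measure_eqI)
    show "sets (CI {0..<n}) = sets (C 0 n (\<lambda>_. undefined))"
      by (simp add: CI_def sets_C)
    fix A assume "A \<in> sets (CI {0..<n})"
    then have A: "A \<in> sets (PiM {0..<n} ?M)"
      by (simp add: CI_def)
    moreover have "PF.emb {0..<n} {0..<n} A = A"
      using sets.sets_into_space[OF A] by (intro prod_emb_id) (auto simp: space_PiM)
    ultimately show "emeasure (CI {0..<n}) A = emeasure (C 0 n (\<lambda>_. undefined)) A"
      by (subst emeasure_CI[of "{0..<n}" n]) auto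
  qed
  then have D: "distr (chain_measure \<mu> K) (PiM {0..<n} ?M) (\<lambda>\<omega>. restrict \<omega> {0..<n}) = C 0 n (\<lambda>_. undefined)"
    using distr_lim[of "{0..<n}"] by (simp add: chain_measure_def)
  have "(\<lambda>\<omega>. restrict \<omega> {0..<n}) \<in> measurable (chain_measure \<mu> K) (PiM {0..<n} ?M)"
    by (simp add: measurable_cong_sets[OF sets_chain_measure refl] measurable_restrict_subset)
  then show ?thesis
    unfolding D[symmetric] by (simp add: nn_integral_distr)
qed

lemma nn_integral_chain_measure_0:
  fixes \<mu> :: "'x pmf" and f :: "'x \<Rightarrow> ennreal"
  shows "(\<integral>\<^sup>+\<omega>. f (\<omega> 0) \<partial>chain_measure \<mu> K) = (\<integral>\<^sup>+x. f x \<partial>\<mu>)"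
proof -
  let ?M = "\<lambda>_::nat. count_space (UNIV :: 'x set)"
  interpret Ionescu_Tulcea "chain_kernel \<mu> K" ?M
    by (rule Ionescu_Tulcea_chain)
  have meas [measurable]: "(\<lambda>\<omega>. f (\<omega> 0)) \<in> borel_measurable (PiM {0..<Suc 0} ?M)"
    by (rule measurable_compose[OF measurable_component_singleton]) auto
  have "(\<integral>\<^sup>+\<omega>. f (\<omega> 0) \<partial>chain_measure \<mu> K) = (\<integral>\<^sup>+\<omega>. f (\<omega> 0) \<partial>C 0 (Suc 0) (\<lambda>_. undefined))"
    using nn_integral_chain_measure_restrict[OF meas] by simp
  also have "C 0 (Suc 0) (\<lambda>_. undefined) = eP 0 (\<lambda>_. undefined)"
    using measurable_eP[of 0] by (simp add: bind_return[where N="PiM {0..<Suc 0} ?M"])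
  also have "(\<integral>\<^sup>+\<omega>. f (\<omega> 0) \<partial>eP 0 (\<lambda>_. undefined)) = (\<integral>\<^sup>+x. f x \<partial>\<mu>)"
    using meas by (subst nn_integral_eP) (auto simp: chain_kernel_def)
  finally show ?thesis .
qed

text \<open>The one-step Markov property, read off from the last kernel of the marginal on
  \<open>{0..<Suc (Suc t)}\<close>. The factor \<open>u\<close> permits conditioning on the state at
  time \<open>t\<close>.\<close>

lemma nn_integral_chain_measure_Suc:
  fixes \<mu> :: "'x pmf" and u f :: "'x \<Rightarrow> ennreal"
  shows "(\<integral>\<^sup>+\<omega>. u (\<omega> t) * f (\<omega> (Suc t)) \<partial>chain_measure \<mu> K) =
    (\<integral>\<^sup>+\<omega>. u (\<omega> t) * (\<integral>\<^sup>+y. f y \<partial>K (\<omega> t)) \<partial>chain_measure \<mu> K)"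
proof -
  let ?M = "\<lambda>_::nat. count_space (UNIV :: 'x set)" and ?z = "\<lambda>_::nat. undefined :: 'x"
  interpret Ionescu_Tulcea "chain_kernel \<mu> K" ?M
    by (rule Ionescu_Tulcea_chain)
  have [measurable]: "(\<lambda>\<omega>. g (\<omega> i)) \<in> borel_measurable (PiM {0..<n} ?M)" if "i < n"
    for i n and g :: "'x \<Rightarrow> ennreal"
    using that by (intro measurable_compose[OF measurable_component_singleton]) auto
  have m1: "(\<lambda>\<omega>. u (\<omega> t) * f (\<omega> (Suc t))) \<in> borel_measurable (PiM {0..<Suc (Suc t)} ?M)"
    by measurable
  have m2: "(\<lambda>\<omega>. u (\<omega> t) * (\<integral>\<^sup>+y. f y \<partial>K (\<omega> t))) \<in> borel_measurable (PiM {0..<Suc t} ?M)"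
    by measurable
  have "(\<integral>\<^sup>+\<omega>. u (\<omega> t) * f (\<omega> (Suc t)) \<partial>chain_measure \<mu> K) =
      (\<integral>\<^sup>+\<omega>. u (\<omega> t) * f (\<omega> (Suc t)) \<partial>C 0 (Suc (Suc t)) ?z)"
    using nn_integral_chain_measure_restrict[OF m1, of \<mu> K] by simp
  also have "\<dots> = (\<integral>\<^sup>+\<omega>. (\<integral>\<^sup>+\<omega>'. u (\<omega>' t) * f (\<omega>' (Suc t)) \<partial>eP (Suc t) \<omega>) \<partial>C 0 (Suc t) ?z)"
    using measurable_eP[of "Suc t"] m1 unfolding C.simps(2)[of 0 "Suc t"]
    by (subst nn_integral_bind[where B="PiM {0..<Suc (Suc t)} ?M"])
      (auto simp: measurable_cong_sets[OF sets_C] simp del: C.simps)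
  also have "\<dots> = (\<integral>\<^sup>+\<omega>. u (\<omega> t) * (\<integral>\<^sup>+y. f y \<partial>K (\<omega> t)) \<partial>C 0 (Suc t) ?z)"
    using m1 by (intro nn_integral_cong, subst nn_integral_eP)
      (auto simp: space_C chain_kernel_def nn_integral_cmult simp del: C.simps)
  also have "\<dots> = (\<integral>\<^sup>+\<omega>. u (\<omega> t) * (\<integral>\<^sup>+y. f y \<partial>K (\<omega> t)) \<partial>chain_measure \<mu> K)"
    using nn_integral_chain_measure_restrict[OF m2, of \<mu> K] by simp
  finally show ?thesis .
qed

section \<open>Potentials and supersolutions\<close>

definition pmf_op :: "('x \<Rightarrow> 'x pmf) \<Rightarrow> ('x \<Rightarrow> ennreal) \<Rightarrow> 'x \<Rightarrow> ennreal" where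
  "pmf_op K f x = (\<integral>\<^sup>+y. f y \<partial>K x)"

text \<open>The potential of the charge \<open>f\<close> in the sense of Markov chain potential
  theory (Green operator applied to \<open>f\<close>).\<close>

definition potential :: "('x \<Rightarrow> 'x pmf) \<Rightarrow> ('x \<Rightarrow> ennreal) \<Rightarrow> 'x \<Rightarrow> ennreal" where
  "potential K f x = (\<Sum>t. (pmf_op K ^^ t) f x)"

text \<open>The Markov property moves back one time step at the price of replacing \<open>f\<close>
  by \<open>pmf_op K f\<close>, hence the induction over arbitrary \<open>f\<close>.\<close>

lemma nn_integral_chain_measure_nth:
  "(\<integral>\<^sup>+\<omega>. f (\<omega> t) \<partial>chain_measure \<mu> K) = (\<integral>\<^sup>+x. (pmf_op K ^^ t) f x \<partial>\<mu>)"
proof (induction t arbitrary: f)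
  case 0
  show ?case by (simp add: nn_integral_chain_measure_0)
next
  case (Suc t)
  have "(\<integral>\<^sup>+\<omega>. f (\<omega> (Suc t)) \<partial>chain_measure \<mu> K) = (\<integral>\<^sup>+\<omega>. pmf_op K f (\<omega> t) \<partial>chain_measure \<mu> K)"
    using nn_integral_chain_measure_Suc[where u="\<lambda>_. 1" and t=t and f=f] by (simp add: pmf_op_def)
  then show ?case
    by (simp add: Suc.IH funpow_swap1)
qed

lemma measurable_chain_nth [measurable]:
  fixes f :: "'x \<Rightarrow> 'b :: topological_space"
  shows "(\<lambda>\<omega>. f (\<omega> t)) \<in> borel_measurable (chain_measure \<mu> K)"
  by (simp add: measurable_cong_sets[OF sets_chain_measure refl],
      rule measurable_compose[OF measurable_component_singleton]) auto

lemma nn_integral_chain_measure_suminf: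
  fixes f :: "'x \<Rightarrow> ennreal"
  shows "(\<integral>\<^sup>+\<omega>. (\<Sum>t. f (\<omega> t)) \<partial>chain_measure \<mu> K) = (\<integral>\<^sup>+x. potential K f x \<partial>\<mu>)"
  by (simp add: nn_integral_suminf nn_integral_chain_measure_nth potential_def)

text \<open>First-step analysis: split off time 0, then interchange series and integral, which is
  always possible for nonnegative terms.\<close>

lemma potential_unfold: "potential K f x = f x + pmf_op K (potential K f) x"
proof -
  have "potential K f x = f x + (\<Sum>t. (pmf_op K ^^ Suc t) f x)"
    using sums_unique[OF sums_Suc[OF summable_sums[OF summableI], of "\<lambda>t. (pmf_op K ^^ t) f x"]]
    unfolding potential_def by (simp add: add.commute)
  also have "(\<Sum>t. (pmf_op K ^^ Suc t) f x) = pmf_op K (potential K f) x"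
    unfolding potential_def pmf_op_def by (simp add: nn_integral_suminf pmf_op_def)
  finally show ?thesis .
qed

text \<open>Induction bounds every partial sum by \<open>W\<close>: its first term is
  \<open>f x\<close>, and the others are \<open>pmf_op K\<close> of a shorter partial sum, hence at
  most \<open>pmf_op K W x\<close>. The closed set \<open>S\<close> is there because costs and
  policies are constrained only on legal state-action pairs.\<close>

lemma potential_le_supersolution:
  assumes inv: "\<And>x. x \<in> S \<Longrightarrow> set_pmf (K x) \<subseteq> S"
    and super: "\<And>x. x \<in> S \<Longrightarrow> f x + pmf_op K W x \<le> W x"
    and x: "x \<in> S"
  shows "potential K f x \<le> W x"
proof -
  have "(\<Sum>t<n. (pmf_op K ^^ t) f x) \<le> W x" for n
    using x
  proof (induction n arbitrary: x)
    case (Suc n)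
    have "(\<Sum>t<Suc n. (pmf_op K ^^ t) f x) = f x + (\<Sum>t<n. pmf_op K ((pmf_op K ^^ t) f) x)"
      by (subst sum.lessThan_Suc_shift) simp
    also have "(\<Sum>t<n. pmf_op K ((pmf_op K ^^ t) f) x) = pmf_op K (\<lambda>y. \<Sum>t<n. (pmf_op K ^^ t) f y) x"
      by (simp add: pmf_op_def nn_integral_sum)
    also have "\<dots> \<le> pmf_op K W x"
      unfolding pmf_op_def[of K W] pmf_op_def[of K "\<lambda>y. \<Sum>t<n. (pmf_op K ^^ t) f y"]
      using Suc inv by (intro nn_integral_mono_AE) (auto simp: AE_measure_pmf_iff)
    finally show ?case
      using super[OF Suc.prems] by (meson add_left_mono order_trans)
  qed simp
  then show ?thesis
    unfolding potential_def suminf_eq_SUP by (rule SUP_least)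
qed

section \<open>Value functions as potentials of the state-action chain\<close>

definition lift_cost :: "('s \<Rightarrow> 'a \<Rightarrow> real) \<Rightarrow> ('s \<times> 'a) option \<Rightarrow> ennreal" where
  "lift_cost c x = (case x of None \<Rightarrow> 0 | Some (s, a) \<Rightarrow> ennreal (c s a))"

text \<open>As the chain moves on state-action pairs, this is an action value: both \<open>Q\<close>
  and \<open>Q_first_action\<close> will coincide with it.\<close>

abbreviation cost_to_go :: "('s, 'a) ssp \<Rightarrow> ('s \<Rightarrow> 'a pmf) \<Rightarrow> ('s \<Rightarrow> 'a \<Rightarrow> real) \<Rightarrow> ('s \<times> 'a) option \<Rightarrow> ennreal"
  where "cost_to_go M \<pi> c \<equiv> potential (step M \<pi>) (lift_cost c)"

lemma lift_cost_simps [simp]: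
  "lift_cost c None = 0" "lift_cost c (Some (s, a)) = ennreal (c s a)"
  by (simp_all add: lift_cost_def)

lemma V_eq: "V M \<pi> c s = (\<integral>\<^sup>+a. cost_to_go M \<pi> c (Some (s, a)) \<partial>\<pi> s)"
  using nn_integral_chain_measure_suminf[where f="lift_cost c" and \<mu>="start \<pi> (Some s)" and K="step M \<pi>"]
  by (simp add: V_def traj_from_def total_cost_def lift_cost_def start_def)

lemma Q_first_action_eq: "Q_first_action M \<pi> c s a = cost_to_go M \<pi> c (Some (s, a))"
  using nn_integral_chain_measure_suminf[where f="lift_cost c" and \<mu>="return_pmf (Some (s, a))" and K="step M \<pi>"]
  by (simp add: Q_first_action_def traj_from_action_def total_cost_def lift_cost_def)

lemma nn_integral_start:
  "(\<integral>\<^sup>+y. W y \<partial>start \<pi> x) = (case x of None \<Rightarrow> W None | Some s \<Rightarrow> \<integral>\<^sup>+a. W (Some (s, a)) \<partial>\<pi> s)"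
  by (cases x) (simp_all add: start_def)

lemma pmf_op_step_Some:
  "pmf_op (step M \<pi>) W (Some (s, a)) =
     (\<integral>\<^sup>+x. (case x of None \<Rightarrow> W None | Some s' \<Rightarrow> \<integral>\<^sup>+a'. W (Some (s', a')) \<partial>\<pi> s') \<partial>transition M s a)"
  by (simp add: pmf_op_def step_def nn_integral_start)

lemma pmf_op_step_None [simp]: "pmf_op (step M \<pi>) W None = W None"
  by (simp add: pmf_op_def step_def)

text \<open>The closed set on which supersolutions are tested.\<close>

definition pairs :: "('s, 'a) ssp \<Rightarrow> ('s \<times> 'a) option set" where
  "pairs M = insert None (Some ` (states M \<times> actions M))"

lemma step_in_pairs:
  assumes "is_ssp M" "is_policy M \<pi>" "x \<in> pairs M"
  shows "set_pmf (step M \<pi> x) \<subseteq> pairs M"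
proof (cases x)
  case (Some y)
  then obtain s a where x: "x = Some (s, a)" and sa: "s \<in> states M" "a \<in> actions M"
    using assms(3) by (auto simp: pairs_def)
  have "set_pmf (start \<pi> z) \<subseteq> pairs M" if "z \<in> set_pmf (transition M s a)" for z
  proof (cases z)
    case (Some s')
    then have "s' \<in> states M"
      using assms(1) sa that by (auto simp: is_ssp_def)
    then show ?thesis
      using assms(2) Some by (auto simp: start_def pairs_def is_policy_def)
  qed (simp add: start_def pairs_def)
  then show ?thesis
    by (auto simp: x step_def)
qed (simp add: step_def pairs_def)

text \<open>The zero function is a supersolution on the closed set \<open>{None}\<close>.\<close>

lemma cost_to_go_None [simp]: "cost_to_go M \<pi> c None = 0"
  using potential_le_supersolution[of "{None}" "step M \<pi>" "lift_cost c" "\<lambda>_. 0"]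
  by (simp add: step_def pmf_op_def)

text \<open>The defining equation of \<open>Q\<close> is one unfolding of the potential.\<close>

lemma Q_eq_cost_to_go: "Q M \<pi> c s a = cost_to_go M \<pi> c (Some (s, a))"
  by (subst potential_unfold) (simp add: Q_def pmf_op_step_Some V_eq[abs_def])

section \<open>Expected visits and the hitting time of the goal\<close>

text \<open>The trajectory space contains sequences that leave the goal; they form a null set
  because \<open>step\<close> fixes \<open>None\<close>.\<close>

lemma AE_absorbing:
  "AE \<omega> in chain_measure \<mu> (step M \<pi>). \<forall>t. \<omega> t = None \<longrightarrow> \<omega> (Suc t) = None"
proof (subst AE_all_countable, rule allI)
  fix t
  let ?P = "chain_measure \<mu> (step M \<pi>)"
  let ?u = "indicator {None} :: ('a \<times> 'b) option \<Rightarrow> ennreal"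
  let ?f = "indicator (- {None}) :: ('a \<times> 'b) option \<Rightarrow> ennreal"
  have "(\<integral>\<^sup>+\<omega>. ?u (\<omega> t) * ?f (\<omega> (Suc t)) \<partial>?P) =
      (\<integral>\<^sup>+\<omega>. ?u (\<omega> t) * (\<integral>\<^sup>+y. ?f y \<partial>step M \<pi> (\<omega> t)) \<partial>?P)"
    by (rule nn_integral_chain_measure_Suc)
  also have "\<dots> = (\<integral>\<^sup>+\<omega>. 0 \<partial>?P)"
    by (intro nn_integral_cong) (auto simp: step_def split: split_indicator)
  finally have "(\<integral>\<^sup>+\<omega>. ?u (\<omega> t) * ?f (\<omega> (Suc t)) \<partial>?P) = 0"
    by simp
  moreover have "(\<lambda>\<omega>. ?u (\<omega> t) * ?f (\<omega> (Suc t))) \<in> borel_measurable ?P"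
    by (intro borel_measurable_times_ennreal measurable_chain_nth)
  ultimately have "AE \<omega> in ?P. ?u (\<omega> t) * ?f (\<omega> (Suc t)) = 0"
    by (simp add: nn_integral_0_iff_AE)
  then show "AE \<omega> in ?P. \<omega> t = None \<longrightarrow> \<omega> (Suc t) = None"
    by eventually_elim (auto simp: indicator_def simp del: not_None_eq split: if_splits)
qed

text \<open>Under absorption, only times before any given visit to \<open>None\<close> contribute.
  If the goal is never reached, the infimum runs over the empty set and is infinite.\<close>

lemma visits_le_steps_to_goal:
  assumes "\<And>t. \<omega> t = None \<Longrightarrow> \<omega> (Suc t) = None"
  shows "total_cost (\<lambda>_ _. 1) \<omega> \<le> steps_to_goal \<omega>"
  unfolding steps_to_goal_def
proof (rule INF_greatest)
  fix t assume "t \<in> {t. \<omega> t = None}"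
  then have "\<omega> t = None" by simp
  have "\<omega> (t + k) = None" for k
    by (induction k) (use \<open>\<omega> t = None\<close> assms in auto)
  then have None: "\<omega> i = None" if "i \<ge> t" for i
    using le_Suc_ex[OF that] by auto
  have "total_cost (\<lambda>_ _. 1) \<omega> = (\<Sum>i<t. case \<omega> i of None \<Rightarrow> 0 | Some (s, a) \<Rightarrow> ennreal 1)"
    unfolding total_cost_def by (rule suminf_finite) (auto simp: None not_less)
  also have "\<dots> \<le> (\<Sum>i<t. 1)"
    by (intro sum_mono) (auto split: option.splits)
  finally show "total_cost (\<lambda>_ _. 1) \<omega> \<le> of_nat t" by simp
qed

lemma V_one_le_T: "1 + V M \<pi> (\<lambda>_ _. 1) s \<le> T M \<pi> s"
  unfolding T_def V_def traj_from_def
proof (intro add_left_mono nn_integral_mono_AE)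
  show "AE \<omega> in chain_measure (start \<pi> (Some s)) (step M \<pi>). total_cost (\<lambda>_ _. 1) \<omega> \<le> steps_to_goal \<omega>"
    using AE_absorbing by eventually_elim (rule visits_le_steps_to_goal, blast)
qed

text \<open>The left-hand side is the quantity \<open>n\<close> of the overview. It averages the
  expected visits from the successor, each bounded through \<open>T\<close> by the maximum; the goal
  contributes 0.\<close>

lemma visits_after_action_le:
  assumes M: "is_ssp M" and sa: "s \<in> states M" "a \<in> actions M"
  shows "pmf_op (step M \<pi>) (cost_to_go M \<pi> (\<lambda>_ _. 1)) (Some (s, a)) \<le> T_max M \<pi>"
proof -
  have T: "T M \<pi> s' \<le> T_max M \<pi>" if "s' \<in> states M" for s'
    using M that unfolding T_max_def is_ssp_def by (intro Max_ge) auto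
  have V: "V M \<pi> (\<lambda>_ _. 1) s' \<le> T_max M \<pi>" if "s' \<in> states M" for s'
    using V_one_le_T[of M \<pi> s'] T[OF that]
    by (meson add_increasing order_refl order_trans zero_le_one zero_le)
  have "pmf_op (step M \<pi>) (cost_to_go M \<pi> (\<lambda>_ _. 1)) (Some (s, a)) \<le> (\<integral>\<^sup>+x. T_max M \<pi> \<partial>transition M s a)"
    unfolding pmf_op_step_Some V_eq[symmetric]
  proof (rule nn_integral_mono_AE, subst AE_measure_pmf_iff, rule ballI)
    fix x assume "x \<in> set_pmf (transition M s a)"
    then have "x \<in> insert None (Some ` states M)"
      using M sa by (auto simp: is_ssp_def)
    then show "(case x of None \<Rightarrow> cost_to_go M \<pi> (\<lambda>_ _. 1) None | Some s' \<Rightarrow> V M \<pi> (\<lambda>_ _. 1) s') \<le> T_max M \<pi>"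
      using V by auto
  qed
  then show ?thesis by simp
qed


section \<open>One step of the stacked chain\<close>

text \<open>Integrating out the layer coin leaves an integral over the transition of
  \<open>M\<close>, which can be compared with the original chain under the integral sign.\<close>

lemma pmf_op_step_stacked:
  assumes h: "h \<le> H" and \<gamma>: "0 \<le> \<gamma>" "\<gamma> \<le> 1"
  shows "pmf_op (step (stacked M H \<gamma>) \<pi>) W (Some ((s, h), a)) =
    (\<integral>\<^sup>+x. (case x of None \<Rightarrow> W None
       | Some s' \<Rightarrow> ennreal \<gamma> * (\<integral>\<^sup>+a'. W (Some ((s', h), a')) \<partial>\<pi> (s', h))
                + ennreal (1 - \<gamma>) * (\<integral>\<^sup>+a'. W (Some ((s', Suc h), a')) \<partial>\<pi> (s', Suc h)))
      \<partial>transition M s a)"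
proof -
  have trans: "transition (stacked M H \<gamma>) (s, h) a = bind_pmf (transition M s a) (\<lambda>x. case x of
           None \<Rightarrow> return_pmf None
         | Some s' \<Rightarrow> map_pmf (\<lambda>stay. Some (s', if stay then h else h + 1)) (bernoulli_pmf \<gamma>))"
    using h by (simp add: stacked_def stacked_transition_def)
  show ?thesis
    unfolding pmf_op_step_Some trans nn_integral_bind_pmf
  proof (rule nn_integral_cong, goal_cases)
    case (1 x)
    then show ?case
      using \<gamma> by (cases x) (simp_all add: mult.commute)
  qed
qed

lemma pmf_op_step_stacked_last:
  assumes "\<not> h \<le> H"
  shows "pmf_op (step (stacked M H \<gamma>) \<pi>) W (Some ((s, h), a)) = W None"
  using assms by (simp add: pmf_op_step_Some stacked_def stacked_transition_def)

lemma Some_in_pairs_stacked: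
  "Some ((s, h), a) \<in> pairs (stacked M H \<gamma>) \<longleftrightarrow> s \<in> states M \<and> h \<in> {1..H + 1} \<and> a \<in> actions M"
  by (auto simp: pairs_def stacked_def)

section \<open>The bound for arbitrary policies\<close>

lemma V_stacked_le:
  assumes M: "is_ssp M" and \<gamma>: "0 < \<gamma>" "\<gamma> < 1" and cf: "0 \<le> c\<^sub>f"
    and c: "\<And>s a. s \<in> states M \<Longrightarrow> a \<in> actions M \<Longrightarrow> c s a \<le> 1"
    and \<pi>: "is_policy (stacked M H \<gamma>) \<pi>" and sh: "s \<in> states M" "h \<in> {1..H}"
  shows "V (stacked M H \<gamma>) \<pi> (stacked_cost H c\<^sub>f c) (s, h)
    \<le> ennreal ((real H - real h + 1) / (1 - \<gamma>) + c\<^sub>f)"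
proof -
  \<comment> \<open>The subtraction is in the reals, so at \<open>h = H + 1\<close> the fraction
    vanishes and \<open>w\<close> is exactly \<open>c\<^sub>f\<close>.\<close>
  define w where "w h = (real H - real h + 1) / (1 - \<gamma>) + c\<^sub>f" for h
  define W :: "(('a \<times> nat) \<times> 'b) option \<Rightarrow> ennreal"
    where "W x = (case x of None \<Rightarrow> 0 | Some ((s, h), a) \<Rightarrow> ennreal (w h))" for x
  let ?M = "stacked M H \<gamma>" and ?c = "stacked_cost H c\<^sub>f c"
  have w_nonneg: "0 \<le> w h" if "h \<le> H + 1" for h
  proof -
    have "0 \<le> real H - real h + 1" using that by linarith
    then show ?thesis using \<gamma> cf by (simp add: w_def)
  qed
  \<comment> \<open>Advancing a layer lowers \<open>w\<close> by \<open>1 / (1 - \<gamma>)\<close>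
    and has probability \<open>1 - \<gamma>\<close>, so the expected drop is 1, the largest cost of
    one step.\<close>
  have w_rec: "1 + (\<gamma> * w h + (1 - \<gamma>) * w (Suc h)) = w h" for h
  proof -
    have "w h - w (Suc h) = 1 / (1 - \<gamma>)"
      by (simp add: w_def diff_divide_distrib[symmetric])
    then have "(1 - \<gamma>) * (w h - w (Suc h)) = 1"
      using \<gamma> by simp
    then show ?thesis
      by (simp add: algebra_simps)
  qed
  have super: "lift_cost ?c x + pmf_op (step ?M \<pi>) W x \<le> W x" if x: "x \<in> pairs ?M" for x
  proof (cases x)
    case None
    then show ?thesis by (simp add: W_def)
  next
    case (Some y)
    obtain s h a where y: "y = ((s, h), a)" by (metis surj_pair)
    have s: "s \<in> states M" "h \<le> H + 1" "a \<in> actions M"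
      using x unfolding Some y Some_in_pairs_stacked by auto
    show ?thesis
    proof (cases "h \<le> H")
      case True
      \<comment> \<open>Successors other than the goal attain the integrand; at the goal
        \<open>W\<close> is 0.\<close>
      have "pmf_op (step ?M \<pi>) W x \<le> (\<integral>\<^sup>+x. ennreal (\<gamma> * w h + (1 - \<gamma>) * w (Suc h)) \<partial>transition M s a)"
        using True \<gamma> w_nonneg[of h] w_nonneg[of "Suc h"]
        unfolding Some y pmf_op_step_stacked[OF True less_imp_le[OF \<gamma>(1)] less_imp_le[OF \<gamma>(2)]]
        by (intro nn_integral_mono)
          (auto simp: W_def ennreal_mult ennreal_plus split: option.splits)
      moreover have "lift_cost ?c x \<le> ennreal 1"
        unfolding Some y using True c[OF s(1,3)] by (simp add: stacked_cost_def ennreal_leI)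
      ultimately have "lift_cost ?c x + pmf_op (step ?M \<pi>) W x
          \<le> ennreal 1 + ennreal (\<gamma> * w h + (1 - \<gamma>) * w (Suc h))"
        by (intro add_mono) auto
      also have "\<dots> = ennreal (1 + (\<gamma> * w h + (1 - \<gamma>) * w (Suc h)))"
        using True \<gamma> w_nonneg[of h] w_nonneg[of "Suc h"] by (intro ennreal_plus[symmetric]) auto
      also have "\<dots> = W x"
        by (simp add: w_rec W_def Some y)
      finally show ?thesis .
    next
      case False
      then have "h = H + 1" using s by simp
      then show ?thesis
        using False by (simp add: Some y pmf_op_step_stacked_last W_def stacked_cost_def w_def)
    qed
  qed
  have "V ?M \<pi> ?c (s, h) \<le> (\<integral>\<^sup>+a. W (Some ((s, h), a)) \<partial>\<pi> (s, h))"
    unfolding V_eq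
  proof (rule nn_integral_mono_AE, subst AE_measure_pmf_iff, rule ballI)
    fix a assume "a \<in> set_pmf (\<pi> (s, h))"
    then have "a \<in> actions M"
      using bspec[OF \<pi>[unfolded is_policy_def], of "(s, h)"] sh by (auto simp: stacked_def)
    then have "Some ((s, h), a) \<in> pairs ?M"
      using sh by (simp add: Some_in_pairs_stacked)
    with step_in_pairs[OF is_ssp_stacked[OF M] \<pi>] super
    show "cost_to_go ?M \<pi> ?c (Some ((s, h), a)) \<le> W (Some ((s, h), a))"
      by (rule potential_le_supersolution)
  qed
  then show ?thesis by (simp add: W_def w_def)
qed

section \<open>The bound for the lifted policy\<close>

text \<open>The lifted policy draws the next action from the same distribution in both possible
  layers, so the two layer terms merge into one integral over \<open>a'\<close> and can be compared
  pointwise.\<close>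

lemma pmf_op_stacked_policy_le:
  assumes M: "is_ssp M" "is_policy M \<pi>" and sa: "s \<in> states M" "a \<in> actions M"
    and h: "h \<le> H" and \<gamma>: "0 \<le> \<gamma>" "\<gamma> \<le> 1"
    and None: "W None \<le> R None"
    and Some: "\<And>s' a'. s' \<in> states M \<Longrightarrow> a' \<in> actions M \<Longrightarrow>
      ennreal \<gamma> * W (Some ((s', h), a')) + ennreal (1 - \<gamma>) * W (Some ((s', Suc h), a')) \<le> R (Some (s', a'))"
  shows "pmf_op (step (stacked M H \<gamma>) (stacked_policy \<pi>)) W (Some ((s, h), a))
    \<le> pmf_op (step M \<pi>) R (Some (s, a))"
  unfolding pmf_op_step_stacked[OF h \<gamma>] pmf_op_step_Some[of M]
proof (rule nn_integral_mono_AE, subst AE_measure_pmf_iff, rule ballI)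
  fix x assume x: "x \<in> set_pmf (transition M s a)"
  show "(case x of None \<Rightarrow> W None
       | Some s' \<Rightarrow> ennreal \<gamma> * (\<integral>\<^sup>+a'. W (Some ((s', h), a')) \<partial>stacked_policy \<pi> (s', h))
                + ennreal (1 - \<gamma>) * (\<integral>\<^sup>+a'. W (Some ((s', Suc h), a')) \<partial>stacked_policy \<pi> (s', Suc h)))
     \<le> (case x of None \<Rightarrow> R None | Some s' \<Rightarrow> \<integral>\<^sup>+a'. R (Some (s', a')) \<partial>\<pi> s')"
  proof (cases x)
    case (Some s')
    then have s': "s' \<in> states M"
      using x M sa by (auto simp: is_ssp_def)
    \<comment> \<open>Here \<open>assms(9)\<close> is the hypothesis \<open>Some\<close>, whose name
      the case distinction shadows.\<close>
    have "(\<integral>\<^sup>+a'. ennreal \<gamma> * W (Some ((s', h), a')) + ennreal (1 - \<gamma>) * W (Some ((s', Suc h), a')) \<partial>\<pi> s')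
        \<le> (\<integral>\<^sup>+a'. R (Some (s', a')) \<partial>\<pi> s')"
      using s' M by (intro nn_integral_mono_AE) (auto simp: AE_measure_pmf_iff is_policy_def intro!: assms(9))
    then show ?thesis
      by (simp add: Some stacked_policy_def nn_integral_add nn_integral_cmult)
  qed (simp add: None)
qed

lemma Q_stacked_policy_le:
  assumes M: "is_ssp M" and \<pi>: "is_policy M \<pi>"
    and \<gamma>: "0 < \<gamma>" "\<gamma> < 1" and T: "\<gamma> = 1 - 1 / (2 * enn2real (T_max M \<pi>))" and cf: "0 \<le> c\<^sub>f"
    and hsa: "h \<in> {1..H}" "s \<in> states M" "a \<in> actions M"
  shows "Q_first_action (stacked M H \<gamma>) (stacked_policy \<pi>) (stacked_cost H c\<^sub>f c) (s, h) a
    \<le> Q M \<pi> c s a + ennreal (c\<^sub>f / 2 ^ (H - h + 1))"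
proof -
  let ?M = "stacked M H \<gamma>" and ?\<pi> = "stacked_policy \<pi>" and ?c = "stacked_cost H c\<^sub>f c"
  define q where "q = cost_to_go M \<pi> c"
  define m where "m = cost_to_go M \<pi> (\<lambda>_ _. 1)"
  define n where "n = pmf_op (step M \<pi>) m"
  \<comment> \<open>Two requirements meet: \<open>D h\<close> times the maximum of \<open>T\<close>
    is \<open>1 / 2 ^ (H + 1 - h)\<close>, and for \<open>h \<le> H\<close> it equals
    \<open>(1 - \<gamma>) / 2 ^ (H - h)\<close>, the share of \<open>p\<close> owed to advancing a
    layer.\<close>
  define D where "D h = 2 * (1 - \<gamma>) / 2 ^ (H + 1 - h)" for h
  \<comment> \<open>\<open>p\<close> serves as an upper bound for the probability of reaching layer
    \<open>H + 1\<close>, the event on which \<open>c\<^sub>f\<close> is paid.\<close>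
  define p where "p h x = (if h \<le> H then ennreal (D h) * n x else 1)" for h x
  define W where "W x = (case x of None \<Rightarrow> 0
    | Some ((s, h), a) \<Rightarrow> q (Some (s, a)) + ennreal c\<^sub>f * p h (Some (s, a)))" for x
  have D_nonneg: "0 \<le> D h" for h
    using \<gamma> by (simp add: D_def)
  \<comment> \<open>\<open>enn2real\<close> maps infinity to \<open>0\<close>, where the hypothesis on \<open>\<gamma>\<close> would read \<open>\<gamma> = 1\<close>.\<close>
  have "enn2real (T_max M \<pi>) \<noteq> 0"
    using T \<gamma> by auto
  then obtain t where t: "T_max M \<pi> = ennreal t" "0 < t"
    by (cases "T_max M \<pi>") (auto simp: less_le)
  then have t\<gamma>: "2 * (1 - \<gamma>) * t = 1"
    using T by simp
  have n_le: "n (Some (s, a)) \<le> ennreal t" if "s \<in> states M" "a \<in> actions M" for s a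
    using visits_after_action_le[OF M that, of \<pi>] by (simp add: n_def m_def t)
  \<comment> \<open>Beyond layer \<open>H\<close> the truncated exponent is 0 and the bound is 1,
    which lets \<open>p_rec\<close> treat \<open>Suc h = H + 1\<close> uniformly.\<close>
  have p_le: "p h (Some (s, a)) \<le> ennreal (1 / 2 ^ (H + 1 - h))" if "s \<in> states M" "a \<in> actions M" for h s a
  proof (cases "h \<le> H")
    case True
    have "ennreal (D h) * n (Some (s, a)) \<le> ennreal (D h) * ennreal t"
      by (intro mult_left_mono n_le that) simp
    also have "\<dots> = ennreal (D h * t)"
      using D_nonneg t by (simp add: ennreal_mult)
    also have "D h * t = 1 / 2 ^ (H + 1 - h)"
      using t\<gamma> by (simp add: D_def)
    finally show ?thesis using True by (simp add: p_def)
  qed (simp add: p_def)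
  have m_Some: "m (Some (s, a)) = 1 + n (Some (s, a))" for s a
    unfolding n_def m_def by (subst potential_unfold) simp
  \<comment> \<open>Staying gives at most \<open>D h * n\<close> after bounding
    \<open>\<gamma>\<close> by 1, advancing gives at most \<open>D h\<close>, and
    \<open>1 + n = m\<close>.\<close>
  have p_rec: "ennreal \<gamma> * p h (Some (s, a)) + ennreal (1 - \<gamma>) * p (Suc h) (Some (s, a))
      \<le> ennreal (D h) * m (Some (s, a))"
    if "h \<le> H" "s \<in> states M" "a \<in> actions M" for h s a
  proof -
    have "ennreal \<gamma> * p h (Some (s, a)) \<le> 1 * (ennreal (D h) * n (Some (s, a)))"
      using that \<gamma> unfolding p_def by (intro mult_mono) auto
    moreover have "ennreal (1 - \<gamma>) * p (Suc h) (Some (s, a)) \<le> ennreal (1 - \<gamma>) * ennreal (1 / 2 ^ (H + 1 - Suc h))"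
      by (intro mult_left_mono p_le that) simp
    moreover have "(1 - \<gamma>) * (1 / 2 ^ (H + 1 - Suc h)) = D h"
      using that by (simp add: D_def Suc_diff_le field_simps)
    then have "ennreal (1 - \<gamma>) * ennreal (1 / 2 ^ (H + 1 - Suc h)) = ennreal (D h)"
      using \<gamma> by (simp add: ennreal_mult[symmetric])
    ultimately have "ennreal \<gamma> * p h (Some (s, a)) + ennreal (1 - \<gamma>) * p (Suc h) (Some (s, a))
        \<le> 1 * (ennreal (D h) * n (Some (s, a))) + ennreal (D h)"
      using add_mono by metis
    then show ?thesis
      by (simp add: m_Some distrib_left add.commute)
  qed
  have super: "lift_cost ?c x + pmf_op (step ?M ?\<pi>) W x \<le> W x" if x: "x \<in> pairs ?M" for x
  proof (cases x)
    case None
    then show ?thesis by (simp add: W_def)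
  next
    case (Some y)
    obtain s h a where y: "y = ((s, h), a)" by (metis surj_pair)
    have s: "s \<in> states M" "a \<in> actions M"
      using x unfolding Some y Some_in_pairs_stacked by auto
    show ?thesis
    proof (cases "h \<le> H")
      case True
      \<comment> \<open>\<open>R\<close> carries \<open>m\<close> where \<open>W\<close> carries
        \<open>n\<close>: one step of the original chain turns \<open>m\<close> back into
        \<open>n\<close>, which closes the supersolution inequality.\<close>
      define R where "R x = q x + ennreal (c\<^sub>f * D h) * m x" for x
      have "pmf_op (step ?M ?\<pi>) W x \<le> pmf_op (step M \<pi>) R (Some (s, a))"
        unfolding Some y
      proof (rule pmf_op_stacked_policy_le[OF M \<pi> s True less_imp_le[OF \<gamma>(1)] less_imp_le[OF \<gamma>(2)]])
        fix s' a' assume s': "s' \<in> states M" "a' \<in> actions M"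
        let ?x = "Some (s', a')"
        have "ennreal \<gamma> * W (Some ((s', h), a')) + ennreal (1 - \<gamma>) * W (Some ((s', Suc h), a')) =
          (ennreal \<gamma> + ennreal (1 - \<gamma>)) * q ?x +
          ennreal c\<^sub>f * (ennreal \<gamma> * p h ?x + ennreal (1 - \<gamma>) * p (Suc h) ?x)"
          by (simp add: W_def algebra_simps)
        also have "ennreal \<gamma> + ennreal (1 - \<gamma>) = 1"
          using \<gamma> by (simp add: ennreal_plus[symmetric] del: ennreal_plus)
        also have "1 * q ?x + ennreal c\<^sub>f * (ennreal \<gamma> * p h ?x + ennreal (1 - \<gamma>) * p (Suc h) ?x)
            \<le> 1 * q ?x + ennreal c\<^sub>f * (ennreal (D h) * m ?x)"
          by (intro add_left_mono mult_left_mono p_rec True s') simp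
        also have "\<dots> = R ?x"
          using cf D_nonneg by (simp add: R_def ennreal_mult mult.assoc)
        finally show "ennreal \<gamma> * W (Some ((s', h), a')) + ennreal (1 - \<gamma>) * W (Some ((s', Suc h), a')) \<le> R ?x" .
      qed (simp add: W_def)
      also have "\<dots> = pmf_op (step M \<pi>) q (Some (s, a)) + ennreal (c\<^sub>f * D h) * n (Some (s, a))"
        unfolding R_def n_def by (simp add: pmf_op_def nn_integral_add nn_integral_cmult)
      finally have "lift_cost ?c x + pmf_op (step ?M ?\<pi>) W x \<le>
          (ennreal (c s a) + pmf_op (step M \<pi>) q (Some (s, a))) + ennreal (c\<^sub>f * D h) * n (Some (s, a))"
        using True by (simp add: Some y stacked_cost_def add.assoc add_left_mono)
      also have "ennreal (c s a) + pmf_op (step M \<pi>) q (Some (s, a)) = q (Some (s, a))"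
        unfolding q_def using potential_unfold[of "step M \<pi>" "lift_cost c" "Some (s, a)"] by simp
      also have "q (Some (s, a)) + ennreal (c\<^sub>f * D h) * n (Some (s, a)) = W x"
        using True cf D_nonneg by (simp add: Some y W_def p_def ennreal_mult mult.assoc)
      finally show ?thesis .
    next
      \<comment> \<open>In the last layer the cost \<open>c\<^sub>f\<close> is paid and the goal
        follows, while \<open>W\<close> is \<open>q\<close> plus \<open>c\<^sub>f\<close>.\<close>
      case False
      then show ?thesis
        by (simp add: Some y pmf_op_step_stacked_last W_def stacked_cost_def p_def)
    qed
  qed
  have "is_policy ?M ?\<pi>"
    using \<pi> by (auto simp: is_policy_def stacked_def stacked_policy_def)
  note inv = step_in_pairs[OF is_ssp_stacked[OF M] this]
  have "Some ((s, h), a) \<in> pairs ?M"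
    using hsa by (simp add: Some_in_pairs_stacked)
  with inv super have "cost_to_go ?M ?\<pi> ?c (Some ((s, h), a)) \<le> W (Some ((s, h), a))"
    by (rule potential_le_supersolution)
  also have "\<dots> \<le> q (Some (s, a)) + ennreal c\<^sub>f * ennreal (1 / 2 ^ (H + 1 - h))"
    using p_le[OF hsa(2,3), of h] by (auto simp: W_def intro!: add_left_mono mult_left_mono)
  also have "\<dots> = Q M \<pi> c s a + ennreal (c\<^sub>f / 2 ^ (H - h + 1))"
    using hsa cf by (simp add: q_def Q_eq_cost_to_go ennreal_mult[symmetric] Suc_diff_le)
  finally show ?thesis
    by (simp add: Q_first_action_eq)
qed

theorem lemma2:
  fixes M :: "('s, 'a) ssp" and \<pi>star :: "'s \<Rightarrow> 'a pmf"
    and H :: nat and \<gamma> c\<^sub>f :: real and c :: "'s \<Rightarrow> 'a \<Rightarrow> real"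
  assumes "is_ssp M"
    and "H \<ge> 1" and "0 < \<gamma>" and "\<gamma> < 1" and "c\<^sub>f \<ge> 0"
    and "\<And>s a. s \<in> states M \<Longrightarrow> a \<in> actions M \<Longrightarrow> 0 \<le> c s a \<and> c s a \<le> 1"
  shows "(\<forall>h\<in>{1..H}. \<forall>s\<in>states M. \<forall>\<pi>. is_policy (stacked M H \<gamma>) \<pi> \<longrightarrow>
            V (stacked M H \<gamma>) \<pi> (stacked_cost H c\<^sub>f c) (s, h)
              \<le> ennreal ((real H - real h + 1) / (1 - \<gamma>) + c\<^sub>f)) \<and>
         (proper M \<pi>star \<and> \<gamma> = 1 - 1 / (2 * enn2real (T_max M \<pi>star)) \<longrightarrow>
          (\<forall>h\<in>{1..H}. \<forall>s\<in>states M. \<forall>a\<in>actions M.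
            Q_first_action (stacked M H \<gamma>) (stacked_policy \<pi>star) (stacked_cost H c\<^sub>f c) (s, h) a
              \<le> Q M \<pi>star c s a + ennreal (c\<^sub>f / 2 ^ (H - h + 1))))"
proof (intro conjI impI ballI allI)
  fix h s and \<pi> :: "'s \<times> nat \<Rightarrow> 'a pmf"
  assume "h \<in> {1..H}" "s \<in> states M" "is_policy (stacked M H \<gamma>) \<pi>"
  then show "V (stacked M H \<gamma>) \<pi> (stacked_cost H c\<^sub>f c) (s, h)
      \<le> ennreal ((real H - real h + 1) / (1 - \<gamma>) + c\<^sub>f)"
    using assms by (intro V_stacked_le) auto
next
  fix h s a
  assume "proper M \<pi>star \<and> \<gamma> = 1 - 1 / (2 * enn2real (T_max M \<pi>star))"
    and hsa: "h \<in> {1..H}" "s \<in> states M" "a \<in> actions M"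
  then have "is_policy M \<pi>star" "\<gamma> = 1 - 1 / (2 * enn2real (T_max M \<pi>star))"
    by (auto simp: proper_def)
  then show "Q_first_action (stacked M H \<gamma>) (stacked_policy \<pi>star) (stacked_cost H c\<^sub>f c) (s, h) a
      \<le> Q M \<pi>star c s a + ennreal (c\<^sub>f / 2 ^ (H - h + 1))"
    using assms hsa by (intro Q_stacked_policy_le)
qed

end
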